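(* Let $r\geq 3$ and let $n_{1},n_{2},\ldots,n_{r}$ be positive integers with $n_{1}\geq n_{r}\geq n_{2}\geq \cdots \geq n_{r-1}$. Then $$\mathrm{def}\left(K_{n_{1},n_{2},\ldots,n_{r}}\right)\leq \sum_{i=2}^{r-1}n_{i}^{2}.$$
   Context: All graphs are finite, simple, undirected. $K_{n_1,\ldots,n_r}$ denotes the complete $r$-partite graph whose vertex set is partitioned into independent sets of sizes $n_1,\ldots,n_r$, with every two vertices in different parts adjacent. For a proper edge-coloring $\alpha$ of a graph $G$ (with positive integer colors) and a vertex $v$, let $S(v,\alpha)$ be the set of colors on edges incident to $v$, and $\mathrm{def}(v,\alpha)=\max S(v,\alpha)-\min S(v,\alpha)-|S(v,\alpha)|+1$. The deficiency of $G$ is $\mathrm{def}(G)=\min_\alpha \sum_{v\in V(G)}\mathrm{def}(v,\alpha)$ over all proper edge-colorings $\alpha$ of $G$; equivalently, the minimum number of pendant edges whose attachment to $G$ yields a graph admitting an interval coloring (a proper edge-coloring with colors $1,\ldots,t$, all used, in which every vertex's color set is an integer interval). *)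

theory Defs
  imports Complex_Main
begin

record 'a ugraph =
  verts :: "'a set"
  edges :: "'a set set"

definition simple_graph :: "'a ugraph \<Rightarrow> bool" where
  "simple_graph G \<longleftrightarrow>
     finite (verts G) \<and> (\<forall>e\<in>edges G. e \<subseteq> verts G \<and> card e = 2)"

definition proper_edge_coloring :: "'a ugraph \<Rightarrow> ('a set \<Rightarrow> nat) \<Rightarrow> bool" where
  "proper_edge_coloring G \<alpha> \<longleftrightarrow>
     (\<forall>e\<in>edges G. \<alpha> e \<ge> 1) \<and>
     (\<forall>e\<in>edges G. \<forall>f\<in>edges G. e \<noteq> f \<and> e \<inter> f \<noteq> {} \<longrightarrow> \<alpha> e \<noteq> \<alpha> f)"

definition spectrum :: "'a ugraph \<Rightarrow> ('a set \<Rightarrow> nat) \<Rightarrow> 'a \<Rightarrow> nat set" where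
  "spectrum G \<alpha> v = \<alpha> ` {e \<in> edges G. v \<in> e}"

text \<open>An isolated vertex has an empty spectrum, for which \<^const>\<open>Max\<close> and
  \<^const>\<open>Min\<close> are unspecified; its deficiency is taken to be 0.\<close>

definition vertex_deficiency :: "'a ugraph \<Rightarrow> ('a set \<Rightarrow> nat) \<Rightarrow> 'a \<Rightarrow> int" where
  "vertex_deficiency G \<alpha> v =
     (let S = spectrum G \<alpha> v in
      if S = {} then 0 else int (Max S) - int (Min S) - int (card S) + 1)"

definition coloring_deficiency :: "'a ugraph \<Rightarrow> ('a set \<Rightarrow> nat) \<Rightarrow> int" where
  "coloring_deficiency G \<alpha> = (\<Sum>v\<in>verts G. vertex_deficiency G \<alpha> v)"

text \<open>For a simple graph the infimum is over a nonempty set of nonnegative integers,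
  hence a minimum; see \<open>deficiency_attained\<close> and \<open>deficiency_le\<close> below.\<close>

definition deficiency :: "'a ugraph \<Rightarrow> int" where
  "deficiency G = (INF \<alpha>\<in>{\<alpha>. proper_edge_coloring G \<alpha>}. coloring_deficiency G \<alpha>)"

text \<open>The parts are indexed by \<open>1, \<dots>, r\<close>; part \<open>i\<close> consists of the \<open>n i\<close> vertices
  \<open>(i, 0), \<dots>, (i, n i - 1)\<close>.\<close>

definition complete_multipartite :: "nat \<Rightarrow> (nat \<Rightarrow> nat) \<Rightarrow> (nat \<times> nat) ugraph" where
  "complete_multipartite r n =
     (let V = Sigma {1..r} (\<lambda>i. {..<n i}) in
      \<lparr> verts = V, edges = {{u, v} | u v. u \<in> V \<and> v \<in> V \<and> fst u \<noteq> fst v} \<rparr>)"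

lemma simple_graph_complete_multipartite: "simple_graph (complete_multipartite r n)"
  by (auto simp: simple_graph_def complete_multipartite_def Let_def card_2_iff)

lemma finite_edges:
  assumes "simple_graph G"
  shows "finite (edges G)"
proof (rule finite_subset)
  show "edges G \<subseteq> Pow (verts G)" "finite (Pow (verts G))"
    using assms by (auto simp: simple_graph_def)
qed

lemma proper_edge_coloring_exists:
  fixes G :: "'a ugraph"
  assumes "simple_graph G"
  shows "\<exists>\<alpha>. proper_edge_coloring G \<alpha>"
proof -
  obtain f :: "'a set \<Rightarrow> nat" where f: "inj_on f (edges G)"
    using finite_imp_inj_to_nat_seg[OF finite_edges[OF assms]] by auto
  have "proper_edge_coloring G (\<lambda>e. Suc (f e))"
    using f by (auto simp: proper_edge_coloring_def dest: inj_onD)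
  then show ?thesis
    by blast
qed

lemma vertex_deficiency_nonneg:
  assumes "simple_graph G"
  shows "vertex_deficiency G \<alpha> v \<ge> 0"
proof (cases "spectrum G \<alpha> v = {}")
  case False
  let ?S = "spectrum G \<alpha> v"
  have fin: "finite ?S"
    using finite_edges[OF assms] by (simp add: spectrum_def)
  then have "?S \<subseteq> {Min ?S..Max ?S}"
    by auto
  then have "card ?S \<le> Max ?S + 1 - Min ?S"
    using card_mono[of "{Min ?S..Max ?S}" ?S] by simp
  moreover have "Min ?S \<le> Max ?S"
    using fin False by simp
  ultimately show ?thesis
    using False by (simp add: vertex_deficiency_def Let_def)
qed (simp add: vertex_deficiency_def)

lemma bdd_below_coloring_deficiency:
  assumes "simple_graph G"
  shows "bdd_below (coloring_deficiency G ` A)"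
  by (rule bdd_belowI[of _ 0])
    (auto simp: coloring_deficiency_def intro!: sum_nonneg vertex_deficiency_nonneg assms)

lemma deficiency_attained:
  assumes "simple_graph G"
  shows "\<exists>\<alpha>. proper_edge_coloring G \<alpha> \<and> deficiency G = coloring_deficiency G \<alpha>"
proof -
  let ?X = "coloring_deficiency G ` {\<alpha>. proper_edge_coloring G \<alpha>}"
  have "?X \<noteq> {}"
    using proper_edge_coloring_exists[OF assms] by auto
  then obtain x where x: "x \<in> ?X" "x < Inf ?X + 1"
    using cInf_lessD[of ?X "Inf ?X + 1"] by auto
  have "Inf ?X \<le> x"
    using x(1) bdd_below_coloring_deficiency[OF assms] by (rule cInf_lower)
  with x have "Inf ?X \<in> ?X"
    by (metis add.commute order_antisym zle_add1_eq_le)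
  then show ?thesis
    by (auto simp: deficiency_def)
qed

lemma deficiency_le:
  assumes "simple_graph G" "proper_edge_coloring G \<alpha>"
  shows "deficiency G \<le> coloring_deficiency G \<alpha>"
  unfolding deficiency_def
  using assms by (intro cINF_lower bdd_below_coloring_deficiency) auto

end

theory Submission
  imports Defs
begin

text \<open>List all vertices part after part, and color an edge by the sum of the positions of its
  endpoints. The colors at a vertex in part \<open>i\<close> are then a translate of the set of positions
  outside part \<open>i\<close>. This is an interval if part \<open>i\<close> is first or last; otherwise it has one gap, of
  length \<open>n i\<close>, so that the \<open>n i\<close> vertices of the part contribute \<open>(n i)\<^sup>2\<close>.\<close>

definition sum_coloring :: "('a \<Rightarrow> nat) \<Rightarrow> 'a set \<Rightarrow> nat" where
  "sum_coloring x e = Suc (sum x e)"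

definition neighbors :: "'a ugraph \<Rightarrow> 'a \<Rightarrow> 'a set" where
  "neighbors G v = {w. {v, w} \<in> edges G}"

lemma neighbors_subset_verts:
  assumes "simple_graph G"
  shows "neighbors G v \<subseteq> verts G"
  using assms by (auto simp: neighbors_def simple_graph_def)

lemma not_self_neighbor:
  assumes "simple_graph G" "w \<in> neighbors G v"
  shows "w \<noteq> v"
  using assms by (auto simp: neighbors_def simple_graph_def)

text \<open>This turns the edges at \<open>v\<close> into an image of \<open>neighbors G v\<close>,
  so that spectra can be computed from neighbor positions.\<close>

lemma incident_edges_eq:
  assumes "simple_graph G"
  shows "{e \<in> edges G. v \<in> e} = (\<lambda>w. {v, w}) ` neighbors G v"
proof (intro equalityI subsetI)
  fix e assume e: "e \<in> {e \<in> edges G. v \<in> e}"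
  then have "card e = 2"
    using assms by (simp add: simple_graph_def)
  then obtain w where "e = {v, w}"
    using e by (auto simp: card_2_iff)
  then show "e \<in> (\<lambda>w. {v, w}) ` neighbors G v"
    using e by (auto simp: neighbors_def)
qed (auto simp: neighbors_def)

text \<open>Adjacent vertices are distinct, so the sum over the set \<open>{v, w}\<close> does not
  collapse to a single term.\<close>

lemma sum_coloring_edge:
  assumes "simple_graph G" "w \<in> neighbors G v"
  shows "sum_coloring x {v, w} = Suc (x v + x w)"
  using not_self_neighbor[OF assms] by (auto simp: sum_coloring_def)

text \<open>Two edges sharing \<open>v\<close> differ in color exactly as their other endpoints
  differ in \<open>x\<close>, and \<open>x\<close> is injective.\<close>

lemma proper_sum_coloring:
  assumes G: "simple_graph G" and inj: "inj_on x (verts G)"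
  shows "proper_edge_coloring G (sum_coloring x)"
  unfolding proper_edge_coloring_def
proof (intro conjI ballI impI)
  fix e f assume e: "e \<in> edges G" and f: "f \<in> edges G" and ef: "e \<noteq> f \<and> e \<inter> f \<noteq> {}"
  then obtain v where "v \<in> e" "v \<in> f"
    by auto
  then have "e \<in> (\<lambda>w. {v, w}) ` neighbors G v" "f \<in> (\<lambda>w. {v, w}) ` neighbors G v"
    using e f by (auto simp flip: incident_edges_eq[OF G])
  then obtain u w where u: "u \<in> neighbors G v" "e = {v, u}"
    and w: "w \<in> neighbors G v" "f = {v, w}"
    by auto
  moreover have "x u \<noteq> x w"
    using u w ef inj neighbors_subset_verts[OF G] by (auto dest: inj_onD)
  ultimately show "sum_coloring x e \<noteq> sum_coloring x f"
    by (simp add: sum_coloring_edge[OF G])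
\<comment> \<open>The remaining goal, that colors are at least 1, is the reason for the
  \<open>Suc\<close> in \<open>sum_coloring\<close>.\<close>
qed (simp add: sum_coloring_def)

lemma vertex_deficiency_sum_coloring_le:
  assumes G: "simple_graph G" and inj: "inj_on x (verts G)"
    and sub: "x ` neighbors G v \<subseteq> {lo..<hi}" and le: "lo \<le> hi"
  shows "vertex_deficiency G (sum_coloring x) v \<le> int hi - int lo - int (card (neighbors G v))"
proof -
  let ?S = "spectrum G (sum_coloring x) v"
  have S: "?S = (\<lambda>w. Suc (x v + x w)) ` neighbors G v"
    by (simp add: spectrum_def incident_edges_eq[OF G] image_image sum_coloring_edge[OF G]
        cong: image_cong)
  have fin: "finite (neighbors G v)"
    using neighbors_subset_verts[OF G] by (rule finite_subset) (use G in \<open>simp add: simple_graph_def\<close>)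
  have "inj_on x (neighbors G v)"
    using inj neighbors_subset_verts[OF G] by (rule inj_on_subset)
  then have card: "card ?S = card (neighbors G v)"
    unfolding S by (intro card_image) (auto simp: inj_on_def)
  show ?thesis
  proof (cases "?S = {}")
    case True
    \<comment> \<open>Without neighbors the deficiency is 0 by convention, and
      \<open>lo \<le> hi\<close> keeps the bound nonnegative.\<close>
    then show ?thesis
      using le card by (simp add: vertex_deficiency_def)
  next
    case False
    have finS: "finite ?S"
      using fin by (simp add: S)
    \<comment> \<open>The \<open>Suc\<close> in the color moves strictness from the upper to the
      lower end of the window.\<close>
    have bounds: "x v + lo < s \<and> s \<le> x v + hi" if "s \<in> ?S" for s
      using that sub by (auto simp: S)
    have "x v + lo < Min ?S" "Max ?S \<le> x v + hi"
      using bounds Min_in[OF finS False] Max_in[OF finS False] by auto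
    then show ?thesis
      using False card by (simp add: vertex_deficiency_def Let_def)
  qed
qed

text \<open>Part \<open>i\<close> will occupy the block of positions from
  \<open>part_offset n i\<close> up to, but excluding, \<open>part_offset n (Suc i)\<close>; thus
  \<open>part_offset n (Suc r)\<close> is the total number of vertices.\<close>

definition part_offset :: "(nat \<Rightarrow> nat) \<Rightarrow> nat \<Rightarrow> nat" where
  "part_offset n i = sum n {1..<i}"

definition position :: "(nat \<Rightarrow> nat) \<Rightarrow> nat \<times> nat \<Rightarrow> nat" where
  "position n v = part_offset n (fst v) + snd v"

lemma part_offset_1 [simp]: "part_offset n (Suc 0) = 0"
  by (simp add: part_offset_def)

lemma part_offset_Suc: "1 \<le> i \<Longrightarrow> part_offset n (Suc i) = part_offset n i + n i"
  by (simp add: part_offset_def)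

lemma part_offset_mono: "i \<le> j \<Longrightarrow> part_offset n i \<le> part_offset n j"
  by (auto simp: part_offset_def intro!: sum_mono2)

lemma verts_complete_multipartite:
  "verts (complete_multipartite r n) = Sigma {1..r} (\<lambda>i. {..<n i})"
  by (simp add: complete_multipartite_def Let_def)

lemma neighbors_complete_multipartite:
  assumes "v \<in> verts (complete_multipartite r n)"
  shows "neighbors (complete_multipartite r n) v = Sigma ({1..r} - {fst v}) (\<lambda>i. {..<n i})"
proof -
  let ?V = "Sigma {1..r} (\<lambda>i. {..<n i})"
  have "{v, w} \<in> edges (complete_multipartite r n) \<longleftrightarrow> w \<in> ?V \<and> fst w \<noteq> fst v" for w
  proof -
    have "{v, w} \<in> edges (complete_multipartite r n)
        \<longleftrightarrow> (\<exists>u u'. {v, w} = {u, u'} \<and> u \<in> ?V \<and> u' \<in> ?V \<and> fst u \<noteq> fst u')"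
      by (simp add: complete_multipartite_def Let_def)
    also have "\<dots> \<longleftrightarrow> w \<in> ?V \<and> fst w \<noteq> fst v"
      using assms unfolding verts_complete_multipartite doubleton_eq_iff by metis
    finally show ?thesis .
  qed
  then show ?thesis
    by (auto simp: neighbors_def)
qed

lemma card_neighbors_complete_multipartite:
  assumes "v \<in> verts (complete_multipartite r n)"
  shows "int (card (neighbors (complete_multipartite r n) v))
    = int (part_offset n (Suc r)) - int (n (fst v))"
proof -
  have "fst v \<in> {1..r}"
    using assms by (auto simp: verts_complete_multipartite)
  then have "sum n {1..r} = n (fst v) + sum n ({1..r} - {fst v})"
    by (intro sum.remove) auto
  then show ?thesis
    by (simp add: neighbors_complete_multipartite[OF assms] part_offset_def
        atLeastLessThanSuc_atLeastAtMost)
qed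

lemma position_bounds:
  assumes "v \<in> verts (complete_multipartite r n)"
  shows "part_offset n (fst v) \<le> position n v" "position n v < part_offset n (Suc (fst v))"
  using assms by (auto simp: verts_complete_multipartite position_def part_offset_Suc)

lemma position_less:
  assumes "v \<in> verts (complete_multipartite r n)" "w \<in> verts (complete_multipartite r n)"
    and "fst v < fst w"
  shows "position n v < position n w"
  using position_bounds[OF assms(1)] position_bounds[OF assms(2)]
    part_offset_mono[of "Suc (fst v)" "fst w" n] assms(3) by linarith

text \<open>Blocks of different parts are disjoint, and within one block the second coordinate
  determines the position.\<close>

lemma inj_on_position: "inj_on (position n) (verts (complete_multipartite r n))"
proof (rule inj_onI)
  fix v w
  assume v: "v \<in> verts (complete_multipartite r n)" and w: "w \<in> verts (complete_multipartite r n)"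
    and eq: "position n v = position n w"
  have "fst v = fst w"
    using position_less[OF v w] position_less[OF w v] eq by (metis less_irrefl linorder_neqE_nat)
  then show "v = w"
    using eq by (simp add: position_def prod_eq_iff)
qed

text \<open>For the first and last part, the neighbors fill a window whose length is the degree. For
  an inner part, the window of all positions exceeds the degree by the size of the vertex's own
  block.\<close>

lemma vertex_deficiency_position_le:
  assumes v: "v \<in> verts (complete_multipartite r n)"
  shows "vertex_deficiency (complete_multipartite r n) (sum_coloring (position n)) v
    \<le> (if fst v \<in> {2..r - 1} then int (n (fst v)) else 0)"
proof -
  let ?G = "complete_multipartite r n" and ?i = "fst v"
  have i: "1 \<le> ?i" "?i \<le> r"
    using v by (auto simp: verts_complete_multipartite)
  \<comment> \<open>With the degree inserted, only the choice of \<open>lo\<close> and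
    \<open>hi\<close> remains in each case.\<close>
  note le = vertex_deficiency_sum_coloring_le[OF simple_graph_complete_multipartite inj_on_position,
      of n r v, unfolded card_neighbors_complete_multipartite[OF v]]
  have nb: "w \<in> verts ?G" "1 \<le> fst w" "fst w \<le> r" "fst w \<noteq> ?i" if "w \<in> neighbors ?G v" for w
    using that by (auto simp: neighbors_complete_multipartite[OF v] verts_complete_multipartite)
  have upper: "position n w < part_offset n (Suc r)" if "w \<in> neighbors ?G v" for w
    using position_bounds(2)[OF nb(1)[OF that]] part_offset_mono[of "Suc (fst w)" "Suc r" n]
      nb(3)[OF that] by simp
  consider "?i = 1" | "?i = r" "?i \<noteq> 1" | "?i \<in> {2..r - 1}"
    using i by fastforce
  then show ?thesis
  proof cases
    case 1
    \<comment> \<open>All neighbors lie after the first block, which ends at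
      \<open>part_offset n 2 = n 1\<close>; this is taken as \<open>lo\<close>.\<close>
    have "n 1 \<le> position n w" if "w \<in> neighbors ?G v" for w
    proof -
      have "part_offset n 2 \<le> part_offset n (fst w)"
        using nb(2,4)[OF that] 1 by (intro part_offset_mono) simp
      then show ?thesis
        using position_bounds(1)[OF nb(1)[OF that]] part_offset_Suc[of 1 n]
        by (simp add: numeral_2_eq_2)
    qed
    moreover have "n 1 \<le> part_offset n (Suc r)"
      using part_offset_mono[of 2 "Suc r" n] part_offset_Suc[of 1 n] i
      by (simp add: numeral_2_eq_2)
    ultimately show ?thesis
      using le[of "n 1" "part_offset n (Suc r)"] upper 1 by fastforce
  next
    case 2
    \<comment> \<open>All neighbors lie before the last block, so \<open>hi\<close> can be its
      starting position.\<close>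
    have "position n w < part_offset n r" if "w \<in> neighbors ?G v" for w
    proof -
      have "part_offset n (Suc (fst w)) \<le> part_offset n r"
        using nb(3,4)[OF that] 2 by (intro part_offset_mono) simp
      then show ?thesis
        using position_bounds(2)[OF nb(1)[OF that]] by simp
    qed
    then have "position n ` neighbors ?G v \<subseteq> {0..<part_offset n r}"
      by auto
    then show ?thesis
      using le[of 0 "part_offset n r"] 2 i by (simp add: part_offset_Suc)
  next
    case 3
    have "position n ` neighbors ?G v \<subseteq> {0..<part_offset n (Suc r)}"
      using upper by auto
    then show ?thesis
      using le[of 0 "part_offset n (Suc r)"] 3 by simp
  qed
qed

lemma coloring_deficiency_position_le:
  "coloring_deficiency (complete_multipartite r n) (sum_coloring (position n))
    \<le> int (\<Sum>i=2..r-1. (n i)\<^sup>2)"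
proof -
  let ?d = "\<lambda>i. if i \<in> {2..r - 1} then int (n i) else 0"
  have "coloring_deficiency (complete_multipartite r n) (sum_coloring (position n))
      \<le> (\<Sum>v\<in>Sigma {1..r} (\<lambda>i. {..<n i}). ?d (fst v))"
    unfolding coloring_deficiency_def verts_complete_multipartite[symmetric]
    by (intro sum_mono vertex_deficiency_position_le)
  also have "\<dots> = (\<Sum>i\<in>{1..r}. \<Sum>k<n i. ?d i)"
    by (subst sum.Sigma) (auto simp: case_prod_beta)
  \<comment> \<open>The square arises from \<open>n i\<close> vertices, each contributing at most
    \<open>n i\<close>.\<close>
  also have "\<dots> = (\<Sum>i\<in>{1..r}. if i \<in> {2..r - 1} then int ((n i)\<^sup>2) else 0)"
    by (intro sum.cong) (auto simp: power2_eq_square)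
  also have "\<dots> = (\<Sum>i\<in>{1..r} \<inter> {2..r - 1}. int ((n i)\<^sup>2))"
    by (rule sum.inter_restrict[symmetric]) simp
  also have "{1..r} \<inter> {2..r - 1} = {2..r - 1}"
    by auto
  finally show ?thesis
    by simp
qed

theorem theorem6:
  fixes r :: nat and n :: "nat \<Rightarrow> nat"
  assumes "r \<ge> 3"
    and "\<And>i. 1 \<le> i \<Longrightarrow> i \<le> r \<Longrightarrow> n i > 0"
    and "n 1 \<ge> n r"
    and "n r \<ge> n 2"
    and "\<And>i. 2 \<le> i \<Longrightarrow> i < r - 1 \<Longrightarrow> n i \<ge> n (i + 1)"
  shows "deficiency (complete_multipartite r n) \<le> int (\<Sum>i=2..r-1. (n i)\<^sup>2)"
  \<comment> \<open>The deficiency is a minimum over proper colorings, so the position coloring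
    alone bounds it from above.\<close>
  using deficiency_le[OF simple_graph_complete_multipartite
      proper_sum_coloring[OF simple_graph_complete_multipartite inj_on_position]]
    coloring_deficiency_position_le
  by (rule order_trans)

end
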